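(* Let $a,c>0$ and $b\in\mathbb R$ with $4ac-b^2>0$, let $R=R(x,y)=\sqrt{ax^2+bxy+cy^2}$, and let $q\ge 0$ be an integer. Let $I^{(1)}_{-1,q}=\int R^{-1}x^q\,dx$ denote an antiderivative in $x$ (with $y$ fixed). Then $$I^{(1)}_{-1,q}=R\,P_{q-1}+C_{q-1}\,y^q\,I^{(1)}_{-1,0},\qquad\text{where}\qquad I^{(1)}_{-1,0}=\frac{1}{\sqrt a}\log\bigl(2\sqrt a\,R+2ax+by\bigr),$$ and the bivariate homogeneous polynomials $P_q=P_q(x,y)$ of degree $q$ and the coefficients $C_q$ are defined by $$P_{-1}=0,\qquad P_0=\frac1a,\qquad P_q=\frac{1}{a(q+1)}\Bigl(x^q-\frac{b(2q+1)}{2}\,y\,P_{q-1}-c\,q\,y^2P_{q-2}\Bigr)\quad(q\ge1),$$ $$C_{-1}=1,\qquad C_0=-\frac{b}{2a},\qquad C_q=\frac{1}{a(q+1)}\Bigl(-\frac{b(2q+1)}{2}\,C_{q-1}-c\,q\,C_{q-2}\Bigr)\quad(q\ge1).$$ That is, at every $(x,y)\in\mathbb R^2\setminus\{(x,0):x\le 0\}$ the partial derivative with respect to $x$ of the right-hand side $R P_{q-1}+C_{q-1}y^q\,\frac{1}{\sqrt a}\log(2\sqrt a R+2ax+by)$ equals $R^{-1}x^q$.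
   Context: Equalities between indefinite integrals are understood up to an additive function independent of the integration variable $x$. *)

theory Defs
  imports Complex_Main "HOL-Computational_Algebra.Polynomial"
begin

text \<open>
  Bivariate real polynomials are elements of \<open>\<real>[x][y]\<close>: the outer variable is \<open>y\<close>, the
  coefficients are polynomials in \<open>x\<close>. Hence \<open>coeff (coeff p j) i\<close> is the coefficient of
  \<open>x\<^sup>i y\<^sup>j\<close>.
\<close>

type_synonym bipoly = "real poly poly"

definition X :: bipoly where "X = [:[:0, 1:]:]"

definition Y :: bipoly where "Y = [:0, 1:]"

definition scale :: "real \<Rightarrow> bipoly \<Rightarrow> bipoly" where
  "scale r p = smult [:r:] p"

definition eval2 :: "bipoly \<Rightarrow> real \<Rightarrow> real \<Rightarrow> real" where
  "eval2 p x y = poly (poly p [:y:]) x"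

text \<open>As usual, the zero polynomial counts as homogeneous of every degree.\<close>

definition homogeneous :: "nat \<Rightarrow> bipoly \<Rightarrow> bool" where
  "homogeneous n p \<longleftrightarrow> (\<forall>i j. coeff (coeff p j) i \<noteq> 0 \<longrightarrow> i + j = n)"

text \<open>
  The recursions start at index \<open>-1\<close>, so the index is an integer; the values at indices
  below \<open>-1\<close> are never used.
\<close>

function P :: "real \<Rightarrow> real \<Rightarrow> real \<Rightarrow> int \<Rightarrow> bipoly" where
  "P a b c q =
    (if q \<le> -1 then 0
     else if q = 0 then scale (1 / a) 1
     else scale (1 / (a * (of_int q + 1)))
       (X ^ nat q
        - scale (b * (2 * of_int q + 1) / 2) (Y * P a b c (q - 1))
        - scale (c * of_int q) (Y\<^sup>2 * P a b c (q - 2))))"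
  by auto
termination by (relation "measure (\<lambda>(a, b, c, q). nat (q + 1))") auto

function C :: "real \<Rightarrow> real \<Rightarrow> real \<Rightarrow> int \<Rightarrow> real" where
  "C a b c q =
    (if q \<le> -1 then 1
     else if q = 0 then - b / (2 * a)
     else 1 / (a * (of_int q + 1)) *
       (- (b * (2 * of_int q + 1) / 2) * C a b c (q - 1) - c * of_int q * C a b c (q - 2)))"
  by auto
termination by (relation "measure (\<lambda>(a, b, c, q). nat (q + 1))") auto

declare P.simps [simp del] C.simps [simp del]

definition R :: "real \<Rightarrow> real \<Rightarrow> real \<Rightarrow> real \<Rightarrow> real \<Rightarrow> real" where
  "R a b c x y = sqrt (a * x\<^sup>2 + b * x * y + c * y\<^sup>2)"

definition log_integral :: "real \<Rightarrow> real \<Rightarrow> real \<Rightarrow> real \<Rightarrow> real \<Rightarrow> real" where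
  "log_integral a b c x y = 1 / sqrt a * ln (2 * sqrt a * R a b c x y + 2 * a * x + b * y)"

definition slit_plane :: "(real \<times> real) set" where
  "slit_plane = UNIV - {(x, 0) | x. x \<le> 0}"

definition antiderivative_x :: "(real \<Rightarrow> real \<Rightarrow> real) \<Rightarrow> (real \<Rightarrow> real \<Rightarrow> real) \<Rightarrow> bool" where
  "antiderivative_x f F \<longleftrightarrow>
    (\<forall>(x, y) \<in> slit_plane. ((\<lambda>t. F t y) has_real_derivative f x y) (at x))"

text \<open>
  Equality of indefinite integrals: up to an additive function of \<open>y\<close>. Every section of the
  slit plane with \<open>y\<close> fixed is an interval, so one function of \<open>y\<close> serves the whole domain.
\<close>

definition eq_integral :: "(real \<Rightarrow> real \<Rightarrow> real) \<Rightarrow> (real \<Rightarrow> real \<Rightarrow> real) \<Rightarrow> bool" where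
  "eq_integral F G \<longleftrightarrow> (\<exists>g. \<forall>(x, y) \<in> slit_plane. F x y = G x y + g y)"

end

theory Submission
  imports Defs
begin

text \<open>
  Write \<open>Q = R\<^sup>2 = ax\<^sup>2 + bxy + cy\<^sup>2\<close> and, for a polynomial \<open>p\<close>, let
  \<open>T p = (2ax + by)/2 \<cdot> p + Q \<cdot> \<partial>p/\<partial>x\<close>. Since \<open>\<partial>R/\<partial>x = (2ax + by)/(2R)\<close>, one has
  \<open>\<partial>(R p)/\<partial>x = T p / R\<close>. Hence, for any antiderivative \<open>I\<^sub>0\<close> of \<open>1/R\<close>, the function
  \<open>R P\<^bsub>q-1\<^esub> + C\<^bsub>q-1\<^esub> y\<^sup>q I\<^sub>0\<close> is an antiderivative of \<open>x\<^sup>q/R\<close> as soon as the purely algebraic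
  identity \<open>T P\<^bsub>q-1\<^esub> + C\<^bsub>q-1\<^esub> y\<^sup>q = x\<^sup>q\<close> holds (lemma \<open>reduction_identity\<close>). The
  recursions are made for it: \<open>T\<close> is linear over functions of \<open>y\<close>, and
  \<open>T x\<^sup>q = a(q+1) x\<^bsup>q+1\<^esup> + b(2q+1)/2 \<cdot> y x\<^sup>q + cq y\<^sup>2 x\<^bsup>q-1\<^esup>\<close>, so subtracting the right
  multiples of the two preceding identities leaves only \<open>a(q+1) x\<^bsup>q+1\<^esup>\<close>.

  That the logarithm is an antiderivative of \<open>1/R\<close> is a direct computation once its argument is
  known to be positive; for \<open>y \<noteq> 0\<close> this follows from \<open>4ac - b\<^sup>2 > 0\<close> and
  \<open>4aR\<^sup>2 - (2ax + by)\<^sup>2 = (4ac - b\<^sup>2) y\<^sup>2\<close> (lemma \<open>log_argument_pos\<close>).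
  Finally, two antiderivatives on the slit plane differ by a function of \<open>y\<close>, because all its
  horizontal sections are intervals (lemma \<open>antiderivative_x_unique\<close>).
\<close>

section \<open>Homogeneity\<close>

lemma homogeneous_0: "homogeneous n 0"
  by (simp add: homogeneous_def)

lemma homogeneous_diff:
  assumes "homogeneous n p" "homogeneous n r"
  shows "homogeneous n (p - r)"
  using assms unfolding homogeneous_def by (metis coeff_diff diff_0_right)

lemma homogeneous_scale: "homogeneous n p \<Longrightarrow> homogeneous n (scale s p)"
  by (auto simp: homogeneous_def scale_def)

lemma homogeneous_Y_mult: "homogeneous n p \<Longrightarrow> homogeneous (Suc n) (Y * p)"
  by (auto simp: homogeneous_def Y_def coeff_pCons split: nat.splits)

lemma homogeneous_X_power: "homogeneous n (X ^ n)"
proof -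
  have "X ^ n = [:monom 1 n:]"
    by (induction n) (simp_all add: X_def one_pCons monom_Suc)
  then show ?thesis
    by (auto simp: homogeneous_def coeff_pCons split: nat.splits if_splits)
qed

section \<open>The recursions, shifted to natural indices\<close>

lemma P_minus_one: "P a b c (-1) = 0"
  by (simp add: P.simps)

lemma P_0: "P a b c 0 = scale (1 / a) 1"
  by (simp add: P.simps)

lemma P_Suc:
  "P a b c (int (Suc n)) = scale (1 / (a * (real n + 2)))
     (X ^ Suc n - scale (b * (2 * real n + 3) / 2) (Y * P a b c (int n))
      - scale (c * (real n + 1)) (Y\<^sup>2 * P a b c (int n - 1)))"
  by (subst P.simps) (simp add: algebra_simps nat_add_distrib)

lemma C_minus_one: "C a b c (-1) = 1"
  by (simp add: C.simps)

lemma C_0: "C a b c 0 = - b / (2 * a)"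
  by (simp add: C.simps)

lemma C_Suc:
  "C a b c (int (Suc n)) = 1 / (a * (real n + 2)) *
     (- (b * (2 * real n + 3) / 2) * C a b c (int n) - c * (real n + 1) * C a b c (int n - 1))"
  by (subst C.simps) (simp add: algebra_simps)

text \<open>
  The term \<open>Y\<^sup>2 P\<^bsub>n-1\<^esub>\<close> is carried through the induction instead of \<open>P\<^bsub>n-1\<^esub>\<close> because its degree
  \<open>n + 1\<close> is a natural number also when \<open>n = 0\<close>.
\<close>

lemma homogeneous_P: "homogeneous n (P a b c (int n))"
proof -
  have "homogeneous n (P a b c (int n)) \<and> homogeneous (Suc n) (Y\<^sup>2 * P a b c (int n - 1))"
  proof (induction n)
    case 0
    show ?case
      using homogeneous_X_power[of 0] by (simp add: P_0 P_minus_one homogeneous_scale homogeneous_0)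
  next
    case (Suc n)
    then have "homogeneous (Suc n) (P a b c (int (Suc n)))"
      unfolding P_Suc
      by (intro homogeneous_scale homogeneous_diff homogeneous_X_power homogeneous_Y_mult) auto
    moreover have "homogeneous (Suc (Suc n)) (Y * (Y * P a b c (int n)))"
      using Suc by (intro homogeneous_Y_mult) simp
    ultimately show ?case
      by (simp add: power2_eq_square mult.assoc)
  qed
  then show ?thesis ..
qed

section \<open>The algebraic reduction identity\<close>

text \<open>
  Freezing \<open>y\<close> turns the partial derivative in \<open>x\<close> into the formal derivative of a univariate
  polynomial.
\<close>

definition slice :: "bipoly \<Rightarrow> real \<Rightarrow> real poly" where
  "slice p y = poly p [:y:]"

lemma eval2_eq_slice: "eval2 p x y = poly (slice p y) x"
  by (simp add: eval2_def slice_def)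

lemma slice_simps:
  "slice 0 y = 0"
  "slice 1 y = 1"
  "slice (p - r) y = slice p y - slice r y"
  "slice (p * r) y = slice p y * slice r y"
  "slice (p ^ n) y = slice p y ^ n"
  "slice (scale s p) y = smult s (slice p y)"
  "slice X y = [:0, 1:]"
  "slice Y y = [:y:]"
  by (simp_all add: slice_def scale_def X_def Y_def)

text \<open>
  This is the operator \<open>T\<close> from the introduction, characterised by \<open>\<partial>(R p)/\<partial>x = T p / R\<close>.
\<close>

definition reduction_operator :: "real \<Rightarrow> real \<Rightarrow> real \<Rightarrow> real \<Rightarrow> real poly \<Rightarrow> real \<Rightarrow> real" where
  "reduction_operator a b c y p x =
     (2 * a * x + b * y) / 2 * poly p x
     + (a * x\<^sup>2 + b * x * y + c * y\<^sup>2) * poly (pderiv p) x"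

lemma reduction_operator_diff:
  "reduction_operator a b c y (p - r) x =
     reduction_operator a b c y p x - reduction_operator a b c y r x"
  by (simp add: reduction_operator_def pderiv_diff field_simps)

lemma reduction_operator_smult:
  "reduction_operator a b c y (smult s p) x = s * reduction_operator a b c y p x"
  by (simp add: reduction_operator_def pderiv_smult algebra_simps)

lemma reduction_operator_X_power:
  "reduction_operator a b c y ([:0, 1:] ^ Suc n) x =
     a * (real n + 2) * x ^ (n + 2) + b * (2 * real n + 3) / 2 * y * x ^ Suc n
     + c * (real n + 1) * y\<^sup>2 * x ^ n"
  by (simp add: reduction_operator_def pderiv_power_Suc pderiv_pCons poly_power
      algebra_simps power2_eq_square del: power_Suc)
    (simp add: field_simps)

text \<open>
  Two consecutive identities feed the next one: in the combination prescribed by the recursion the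
  terms in \<open>y x\<^sup>q\<close> and \<open>y\<^sup>2 x\<^bsup>q-1\<^esup>\<close> of \<open>T x\<^sup>q\<close> cancel. The chain starts at index \<open>-1\<close> with the
  identity \<open>0 + 1 = x\<^sup>0\<close>.
\<close>

lemma reduction_identity:
  assumes "a > 0"
  shows "reduction_operator a b c y (slice (P a b c (int q - 1)) y) x
           + C a b c (int q - 1) * y ^ q = x ^ q"
proof -
  define T where "T p = reduction_operator a b c y p x" for p
  define p where "p m = slice (P a b c (int m - 1)) y" for m
  define k where "k m = C a b c (int m - 1)" for m
  have "T (p m) + k m * y ^ m = x ^ m \<and> T (p (Suc m)) + k (Suc m) * y ^ Suc m = x ^ Suc m" for m
  proof (induction m)
    case 0
    show ?case
      using assms
      by (simp add: T_def p_def k_def P_minus_one C_minus_one P_0 C_0 slice_simps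
          reduction_operator_def pderiv_smult field_simps)
  next
    case (Suc m)
    define s where "s = a * (real m + 2)"
    define \<beta> where "\<beta> = b * (2 * real m + 3) / 2"
    define \<gamma> where "\<gamma> = c * (real m + 1)"
    have "s \<noteq> 0"
      using assms by (simp add: s_def)
    have p: "p (Suc (Suc m)) = smult (1 / s)
        ([:0, 1:] ^ Suc m - smult (\<beta> * y) (p (Suc m)) - smult (\<gamma> * y\<^sup>2) (p m))"
      using P_Suc[of a b c m]
      by (simp add: p_def s_def \<beta>_def \<gamma>_def slice_simps power2_eq_square smult_diff_right mult_ac)
    have k: "s * k (Suc (Suc m)) = - \<beta> * k (Suc m) - \<gamma> * k m"
      using C_Suc[of a b c m] \<open>s \<noteq> 0\<close> by (simp add: k_def s_def \<beta>_def \<gamma>_def)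
    have "s * T (p (Suc (Suc m))) = T ([:0, 1:] ^ Suc m) - \<beta> * y * T (p (Suc m)) - \<gamma> * y\<^sup>2 * T (p m)"
      using \<open>s \<noteq> 0\<close> unfolding p T_def reduction_operator_smult reduction_operator_diff by simp
    moreover have "T ([:0, 1:] ^ Suc m) = s * x ^ (m + 2) + \<beta> * y * x ^ Suc m + \<gamma> * y\<^sup>2 * x ^ m"
      unfolding T_def s_def \<beta>_def \<gamma>_def by (rule reduction_operator_X_power)
    moreover have "T (p m) = x ^ m - k m * y ^ m" "T (p (Suc m)) = x ^ Suc m - k (Suc m) * y ^ Suc m"
      using Suc by auto
    ultimately have "s * T (p (Suc (Suc m)))
        = s * x ^ (m + 2) + (\<beta> * k (Suc m) + \<gamma> * k m) * y ^ (m + 2)"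
      by (simp add: algebra_simps power2_eq_square)
    also have "\<beta> * k (Suc m) + \<gamma> * k m = - (s * k (Suc (Suc m)))"
      using k by simp
    finally have "s * (T (p (Suc (Suc m))) + k (Suc (Suc m)) * y ^ (m + 2)) = s * x ^ (m + 2)"
      by (simp add: algebra_simps)
    then show ?case
      using Suc \<open>s \<noteq> 0\<close> by simp
  qed
  then show ?thesis
    by (simp add: T_def p_def k_def)
qed

section \<open>Derivatives on the slit plane\<close>

lemma radicand_pos:
  fixes a b c x y :: real
  assumes "a > 0" "4 * a * c - b\<^sup>2 > 0" "(x, y) \<in> slit_plane"
  shows "a * x\<^sup>2 + b * x * y + c * y\<^sup>2 > 0"
proof -
  have "4 * a * (a * x\<^sup>2 + b * x * y + c * y\<^sup>2) = (2 * a * x + b * y)\<^sup>2 + (4 * a * c - b\<^sup>2) * y\<^sup>2"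
    by (simp add: power2_eq_square algebra_simps)
  moreover have "(2 * a * x + b * y)\<^sup>2 + (4 * a * c - b\<^sup>2) * y\<^sup>2 > 0"
  proof (cases "y = 0")
    case True
    then show ?thesis
      using assms by (simp add: slit_plane_def)
  next
    case False
    then show ?thesis
      using assms by (intro add_nonneg_pos) auto
  qed
  ultimately show ?thesis
    using \<open>a > 0\<close> by (metis mult_pos_pos zero_less_mult_pos zero_less_numeral)
qed

text \<open>
  For \<open>y \<noteq> 0\<close> the condition \<open>4ac - b\<^sup>2 > 0\<close> gives \<open>\<bar>2ax + by\<bar> < 2\<surd>a R\<close>. On the axis this becomes an
  equality, and there \<open>x > 0\<close> makes both summands positive.
\<close>

lemma log_argument_pos:
  fixes a b c x y :: real
  assumes "a > 0" "4 * a * c - b\<^sup>2 > 0" "(x, y) \<in> slit_plane"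
  shows "2 * sqrt a * R a b c x y + 2 * a * x + b * y > 0"
proof (cases "y = 0")
  case True
  then have "x > 0"
    using assms by (auto simp: slit_plane_def)
  with True show ?thesis
    using assms by (auto intro!: add_nonneg_pos mult_nonneg_nonneg simp: R_def)
next
  case False
  have "R a b c x y ^ 2 = a * x\<^sup>2 + b * x * y + c * y\<^sup>2"
    using radicand_pos[OF assms] by (simp add: R_def)
  then have "(2 * sqrt a * R a b c x y)\<^sup>2 = 4 * a * (a * x\<^sup>2 + b * x * y + c * y\<^sup>2)"
    using assms by (simp add: power_mult_distrib)
  also have "\<dots> = (2 * a * x + b * y)\<^sup>2 + (4 * a * c - b\<^sup>2) * y\<^sup>2"
    by (simp add: power2_eq_square algebra_simps)
  also have "\<dots> > (2 * a * x + b * y)\<^sup>2"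
    using assms False by simp
  finally have "\<bar>2 * a * x + b * y\<bar> < \<bar>2 * sqrt a * R a b c x y\<bar>"
    by (metis abs_le_square_iff not_le)
  moreover have "2 * sqrt a * R a b c x y \<ge> 0"
    using radicand_pos[OF assms] assms by (simp add: R_def)
  ultimately show ?thesis
    by linarith
qed

lemma R_has_derivative:
  fixes a b c x y :: real
  assumes "a > 0" "4 * a * c - b\<^sup>2 > 0" "(x, y) \<in> slit_plane"
  shows "((\<lambda>t. R a b c t y) has_real_derivative (2 * a * x + b * y) / (2 * R a b c x y)) (at x)"
  unfolding R_def using radicand_pos[OF assms]
  by (auto intro!: derivative_eq_intros simp: field_simps)

lemma log_integral_antiderivative:
  fixes a b c :: real
  assumes "a > 0" "4 * a * c - b\<^sup>2 > 0"
  shows "antiderivative_x (\<lambda>x y. inverse (R a b c x y)) (log_integral a b c)"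
proof -
  have "((\<lambda>t. log_integral a b c t y) has_real_derivative inverse (R a b c x y)) (at x)"
    if "(x, y) \<in> slit_plane" for x y
  proof -
    define r where "r = R a b c x y"
    define l where "l = 2 * a * x + b * y"
    have r: "r > 0"
      using radicand_pos[OF assms that] by (simp add: r_def R_def)
    have pos: "2 * sqrt a * r + l > 0"
      using log_argument_pos[OF assms that] by (simp add: r_def l_def add.assoc)
    have dR: "((\<lambda>t. R a b c t y) has_real_derivative l / (2 * r)) (at x)"
      using R_has_derivative[OF assms that] by (simp add: r_def l_def)
    have "((\<lambda>t. 2 * sqrt a * R a b c t y + 2 * a * t + b * y) has_real_derivative
        2 * sqrt a * (l / (2 * r)) + 2 * a) (at x)"
      by (rule derivative_eq_intros dR refl | simp)+
    from DERIV_cmult[OF DERIV_chain2[OF DERIV_ln_divide[OF log_argument_pos[OF assms that]] this]]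
    have "((\<lambda>t. log_integral a b c t y) has_real_derivative
        1 / sqrt a * (1 / (2 * sqrt a * r + l) * (2 * sqrt a * (l / (2 * r)) + 2 * a))) (at x)"
      by (simp only: log_integral_def r_def l_def add.assoc)
    \<comment> \<open>The inner derivative is the argument of the logarithm times \<open>\<surd>a/R\<close>.\<close>
    moreover have "2 * sqrt a * (l / (2 * r)) + 2 * a = sqrt a / r * (2 * sqrt a * r + l)"
      using r \<open>a > 0\<close> by (simp add: field_simps)
    ultimately show ?thesis
      using pos \<open>a > 0\<close> by (simp add: r_def[symmetric] inverse_eq_divide)
  qed
  then show ?thesis
    by (auto simp: antiderivative_x_def)
qed

text \<open>
  The reduction formula at the level of derivatives, with an arbitrary antiderivative \<open>I\<close> of
  \<open>1/R\<close>: only its derivative matters, so the logarithm is just one instance.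
\<close>

lemma reduction_formula_antiderivative:
  fixes a b c :: real
  assumes "a > 0" "4 * a * c - b\<^sup>2 > 0"
    and I: "antiderivative_x (\<lambda>x y. inverse (R a b c x y)) I"
  shows "antiderivative_x (\<lambda>x y. inverse (R a b c x y) * x ^ q)
    (\<lambda>x y. R a b c x y * eval2 (P a b c (int q - 1)) x y + C a b c (int q - 1) * y ^ q * I x y)"
proof -
  have "((\<lambda>t. R a b c t y * eval2 (P a b c (int q - 1)) t y + C a b c (int q - 1) * y ^ q * I t y)
      has_real_derivative inverse (R a b c x y) * x ^ q) (at x)"
    if "(x, y) \<in> slit_plane" for x y
  proof -
    define r where "r = R a b c x y"
    define l where "l = 2 * a * x + b * y"
    define p where "p = slice (P a b c (int q - 1)) y"
    define k where "k = C a b c (int q - 1)"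
    have r: "r > 0" and r2: "a * x\<^sup>2 + b * x * y + c * y\<^sup>2 = r * r"
      using radicand_pos[OF assms(1,2) that] by (simp_all add: r_def R_def)
    have dI: "((\<lambda>t. I t y) has_real_derivative inverse r) (at x)"
      using I that by (auto simp: antiderivative_x_def r_def)
    have dR: "((\<lambda>t. R a b c t y) has_real_derivative l / (2 * r)) (at x)"
      using R_has_derivative[OF assms(1,2) that] by (simp add: r_def l_def)
    have "((\<lambda>t. R a b c t y * poly p t + k * y ^ q * I t y) has_real_derivative
        l / (2 * r) * poly p x + poly (pderiv p) x * r + k * y ^ q * inverse r) (at x)"
      using DERIV_add[OF DERIV_mult[OF dR poly_DERIV] DERIV_cmult[OF dI]]
      by (simp add: r_def)
    moreover have "l / (2 * r) * poly p x + poly (pderiv p) x * r + k * y ^ q * inverse r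
        = inverse r * (l / 2 * poly p x + r * r * poly (pderiv p) x + k * y ^ q)"
      using r by (simp add: field_simps)
    moreover have "l / 2 * poly p x + r * r * poly (pderiv p) x + k * y ^ q = x ^ q"
      using reduction_identity[OF \<open>a > 0\<close>, of b c y q x]
      by (simp only: reduction_operator_def r2 l_def p_def k_def)
    ultimately show ?thesis
      by (simp add: eval2_eq_slice p_def k_def r_def)
  qed
  then show ?thesis
    by (auto simp: antiderivative_x_def)
qed

text \<open>
  The point \<open>x = 1\<close> lies in every horizontal section, so \<open>F 1 y - G 1 y\<close> can serve as the additive
  function of \<open>y\<close> throughout.
\<close>

lemma antiderivative_x_unique:
  assumes F: "antiderivative_x f F" and G: "antiderivative_x f G"
  shows "eq_integral F G"
proof -
  have "F x y - G x y = F 1 y - G 1 y" if "(x, y) \<in> slit_plane" for x y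
  proof -
    define l where "l = (if y = 0 then 0 else min x 1 - 1)"
    define u where "u = max x 1 + 1"
    have "l < u" "x \<in> {l<..<u}" "1 \<in> {l<..<u}"
      using that by (auto simp: l_def u_def slit_plane_def)
    moreover have "((\<lambda>t. F t y - G t y) has_real_derivative 0) (at t)" if "t \<in> {l<..<u}" for t
    proof -
      have "(t, y) \<in> slit_plane"
        using that by (auto simp: l_def slit_plane_def)
      then have "((\<lambda>t. F t y) has_real_derivative f t y) (at t)"
        "((\<lambda>t. G t y) has_real_derivative f t y) (at t)"
        using F G by (auto simp: antiderivative_x_def)
      then show ?thesis
        using DERIV_diff by fastforce
    qed
    ultimately show ?thesis
      by (rule DERIV_isconst3)
  qed
  then show ?thesis
    unfolding eq_integral_def by (intro exI[of _ "\<lambda>y. F 1 y - G 1 y"]) force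
qed

section \<open>The reduction formula\<close>

theorem lemma14:
  fixes a b c :: real and q :: nat
  assumes "a > 0" and "c > 0" and "4 * a * c - b\<^sup>2 > 0"
  shows "homogeneous q (P a b c (int q))
    \<and> (\<forall>I\<^sub>q I\<^sub>0.
          antiderivative_x (\<lambda>x y. inverse (R a b c x y) * x ^ q) I\<^sub>q \<longrightarrow>
          antiderivative_x (\<lambda>x y. inverse (R a b c x y)) I\<^sub>0 \<longrightarrow>
          eq_integral I\<^sub>q (\<lambda>x y. R a b c x y * eval2 (P a b c (int q - 1)) x y
                               + C a b c (int q - 1) * y ^ q * I\<^sub>0 x y)
          \<and> eq_integral I\<^sub>0 (log_integral a b c))
    \<and> (\<forall>(x, y) \<in> slit_plane.
          ((\<lambda>t. R a b c t y * eval2 (P a b c (int q - 1)) t y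
               + C a b c (int q - 1) * y ^ q * log_integral a b c t y)
            has_real_derivative inverse (R a b c x y) * x ^ q) (at x))"
proof -
  note log = log_integral_antiderivative[OF assms(1,3)]
  note formula = reduction_formula_antiderivative[OF assms(1,3), of _ q]
  show ?thesis
  proof (intro conjI allI impI)
    show "homogeneous q (P a b c (int q))"
      by (rule homogeneous_P)
  next
    fix I\<^sub>q I\<^sub>0
    assume "antiderivative_x (\<lambda>x y. inverse (R a b c x y) * x ^ q) I\<^sub>q"
      and "antiderivative_x (\<lambda>x y. inverse (R a b c x y)) I\<^sub>0"
    then show "eq_integral I\<^sub>q (\<lambda>x y. R a b c x y * eval2 (P a b c (int q - 1)) x y
        + C a b c (int q - 1) * y ^ q * I\<^sub>0 x y)"
      by (intro antiderivative_x_unique[OF _ formula])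
  next
    fix I\<^sub>q I\<^sub>0
    assume "antiderivative_x (\<lambda>x y. inverse (R a b c x y)) I\<^sub>0"
    then show "eq_integral I\<^sub>0 (log_integral a b c)"
      using log by (rule antiderivative_x_unique)
  next
    show "\<forall>(x, y) \<in> slit_plane.
        ((\<lambda>t. R a b c t y * eval2 (P a b c (int q - 1)) t y
             + C a b c (int q - 1) * y ^ q * log_integral a b c t y)
          has_real_derivative inverse (R a b c x y) * x ^ q) (at x)"
      using formula[OF log] by (simp add: antiderivative_x_def)
  qed
qed

end
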